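(* Let $N\ge2$. The closure of $\mathcal{S}_\omega$ contains the polytope $P=\operatorname{conv}(f(\mathcal{V}))$ (the appropriately scaled Voronoi cell, around the origin, of the root lattice $\{x\in\mathbb{Z}^N:\sum_i x_i=0\}$), and the set $f(\mathcal{V})$ lies on the boundary of $\mathcal{S}_\omega$, where the boundary is taken relative to the hyperplane $\{x\in\mathbb{R}^N:\sum_i x_i=0\}$.
   Context: For $\theta\in\mathbb{T}^N=(\mathbb{R}/2\pi\mathbb{Z})^N$ define $f:\mathbb{T}^N\to\mathbb{R}^N$ by $f_i(\theta)=\sum_{j=1}^N\sin(\theta_j-\theta_i)$, whose image lies in the hyperplane $\{x\in\mathbb{R}^N:\sum_i x_i=0\}$. Define $\kappa_i(\theta)=\sum_{j=1}^N\cos(\theta_j-\theta_i)$. Let $\mathcal{S}_\theta$ be the set of $\theta\in\mathbb{T}^N$ for which $\kappa_i(\theta)\ge0$ for all $i$ and $\sum_{i=1}^N\kappa_i(\theta)^{-1}\le 2$ (where $1/0=+\infty$), and let $\mathcal{S}_\omega=f(\mathcal{S}_\theta)$. The set $\mathcal{V}$ is $\{0,\pi/2\}^N\setminus\{(0,\dots,0),(\pi/2,\dots,\pi/2)\}$. *)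

theory Defs
  imports "HOL-Analysis.Analysis"
begin

text \<open>
  Points of the torus \<open>(\<real>/2\<pi>\<int>)\<^sup>N\<close> are given by representatives in \<open>\<real>\<^sup>N\<close>, where \<open>N\<close> is the
  cardinality of the index type. The lemma \<open>torus_invariant\<close> shows that all functions and
  conditions below depend only on the class modulo \<open>2\<pi>\<int>\<^sup>N\<close>.
\<close>

definition torus_eq :: "real ^ 'n \<Rightarrow> real ^ 'n \<Rightarrow> bool" where
  "torus_eq \<theta> \<theta>' \<longleftrightarrow> (\<forall>i. \<exists>k::int. \<theta>' $ i = \<theta> $ i + 2 * pi * of_int k)"

definition f :: "real ^ 'n \<Rightarrow> real ^ 'n" where
  "f \<theta> = (\<chi> i. \<Sum>j\<in>UNIV. sin (\<theta> $ j - \<theta> $ i))"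

definition \<kappa> :: "'n \<Rightarrow> real ^ 'n \<Rightarrow> real" where
  "\<kappa> i \<theta> = (\<Sum>j\<in>UNIV. cos (\<theta> $ j - \<theta> $ i))"

text \<open>In \<^typ>\<open>ereal\<close> one has \<open>1 / 0 = \<infinity>\<close>, so the sum condition excludes vanishing \<open>\<kappa> i \<theta>\<close>.\<close>

definition S_theta :: "(real ^ 'n) set" where
  "S_theta = {\<theta>. (\<forall>i. \<kappa> i \<theta> \<ge> 0) \<and> (\<Sum>i\<in>UNIV. 1 / ereal (\<kappa> i \<theta>)) \<le> 2}"

definition S_omega :: "(real ^ 'n) set" where
  "S_omega = f ` S_theta"

definition V :: "(real ^ 'n) set" where
  "V = {\<theta>. \<forall>i. \<theta> $ i \<in> {0, pi / 2}} - {(\<chi> i. 0), (\<chi> i. pi / 2)}"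

definition P :: "(real ^ 'n) set" where
  "P = convex hull (f ` V)"

definition hyperplane0 :: "(real ^ 'n) set" where
  "hyperplane0 = {x. (\<Sum>i\<in>UNIV. x $ i) = 0}"

definition root_lattice :: "(real ^ 'n) set" where
  "root_lattice = {x. (\<forall>i. x $ i \<in> \<int>) \<and> (\<Sum>i\<in>UNIV. x $ i) = 0}"

text \<open>The root lattice spans only \<open>hyperplane0\<close>, and its Voronoi cell is taken inside that space.\<close>

definition voronoi_cell :: "(real ^ 'n) set" where
  "voronoi_cell = {x \<in> hyperplane0. \<forall>v\<in>root_lattice. dist x 0 \<le> dist x v}"

lemma sin_cos_shift:
  assumes "torus_eq \<theta> \<theta>'"
  shows "sin (\<theta>' $ j - \<theta>' $ i) = sin (\<theta> $ j - \<theta> $ i)"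
    and "cos (\<theta>' $ j - \<theta>' $ i) = cos (\<theta> $ j - \<theta> $ i)"
proof -
  obtain k l :: int where "\<theta>' $ j = \<theta> $ j + 2 * pi * of_int k" "\<theta>' $ i = \<theta> $ i + 2 * pi * of_int l"
    using assms unfolding torus_eq_def by blast
  then have eq: "\<theta>' $ j - \<theta>' $ i = (\<theta> $ j - \<theta> $ i) + 2 * pi * of_int (k - l)"
    by (simp add: algebra_simps)
  show "sin (\<theta>' $ j - \<theta>' $ i) = sin (\<theta> $ j - \<theta> $ i)"
    unfolding eq sin_add by (simp del: of_int_diff)
  show "cos (\<theta>' $ j - \<theta>' $ i) = cos (\<theta> $ j - \<theta> $ i)"
    unfolding eq cos_add by (simp del: of_int_diff)
qed

lemma torus_invariant:
  assumes "torus_eq \<theta> \<theta>'"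
  shows "f \<theta>' = f \<theta>" "\<kappa> i \<theta>' = \<kappa> i \<theta>" "\<theta>' \<in> S_theta \<longleftrightarrow> \<theta> \<in> S_theta"
  unfolding f_def S_theta_def \<kappa>_def by (simp_all add: sin_cos_shift[OF assms])

end

theory Submission
  imports Defs
begin

text \<open>
  With \<open>C = \<Sum>j cos \<theta>\<^sub>j\<close> and \<open>S = \<Sum>j sin \<theta>\<^sub>j\<close> one has \<open>f\<^sub>i\<^sup>2 + \<kappa>\<^sub>i\<^sup>2 = C\<^sup>2 + S\<^sup>2 = \<Sum>i \<kappa>\<^sub>i\<close>. Conversely, given
  \<open>\<omega>\<close> in the hyperplane, a solution of \<open>u = \<Sum>i sqrt (u - \<omega>\<^sub>i\<^sup>2)\<close> yields a preimage of \<open>\<omega>\<close> under \<open>f\<close>,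
  and the condition \<open>\<Sum>i 1/\<kappa>\<^sub>i \<le> 2\<close> says that \<open>u - \<Sum>i sqrt (u - \<omega>\<^sub>i\<^sup>2)\<close> has nonnegative derivative
  at that solution, as it does at the largest one. Hence \<open>S_omega\<close> is the set of \<open>\<omega>\<close> for which some
  \<open>u\<close> satisfies \<open>u \<le> \<Sum>i sqrt (u - \<omega>\<^sub>i\<^sup>2)\<close>, the projection of a convex set. It contains \<open>f ` V\<close>,
  thus also \<open>P\<close>.

  At a point of \<open>V\<close> the numbers \<open>\<kappa>\<^sub>i\<close> are positive with \<open>\<Sum>i 1/\<kappa>\<^sub>i = 2\<close>; at such points the tangent line
  bound \<open>2 c k \<le> k\<^sup>2 + c\<^sup>2\<close>, with \<open>c = \<kappa>\<^sub>i\<close>, shows that scaling \<open>\<omega>\<close> up leaves \<open>S_omega\<close>.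

  The Voronoi cell is \<open>{x. \<forall>i j. x\<^sub>i - x\<^sub>j \<le> 1}\<close> inside the hyperplane, which is a linear image of the
  unit cube; the vertices of the cube are sent to \<open>0\<close> and the points of \<open>f ` V\<close>, up to scale.
\<close>

section \<open>The image of the stable set is convex\<close>

lemma f_nth:
  "f \<theta> $ i = (\<Sum>j\<in>UNIV. sin (\<theta> $ j)) * cos (\<theta> $ i) - (\<Sum>j\<in>UNIV. cos (\<theta> $ j)) * sin (\<theta> $ i)"
  by (simp add: f_def sin_diff sum_subtractf sum_distrib_right)

lemma \<kappa>_eq:
  "\<kappa> i \<theta> = (\<Sum>j\<in>UNIV. cos (\<theta> $ j)) * cos (\<theta> $ i) + (\<Sum>j\<in>UNIV. sin (\<theta> $ j)) * sin (\<theta> $ i)"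
  by (simp add: \<kappa>_def cos_diff sum.distrib sum_distrib_right)

lemma sum_\<kappa>:
  "(\<Sum>i\<in>UNIV. \<kappa> i \<theta>) = (\<Sum>j\<in>UNIV. cos (\<theta> $ j))\<^sup>2 + (\<Sum>j\<in>UNIV. sin (\<theta> $ j))\<^sup>2"
  by (simp add: \<kappa>_eq sum.distrib sum_distrib_left[symmetric] power2_eq_square)

lemma f_power2_add_\<kappa>_power2: "(f \<theta> $ i)\<^sup>2 + (\<kappa> i \<theta>)\<^sup>2 = (\<Sum>j\<in>UNIV. \<kappa> j \<theta>)"
proof -
  have "(s * y - c * x)\<^sup>2 + (c * y + s * x)\<^sup>2 = (c\<^sup>2 + s\<^sup>2) * (x\<^sup>2 + y\<^sup>2)" for s c x y :: real
    by algebra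
  then show ?thesis
    by (simp add: f_nth \<kappa>_eq[of i] sum_\<kappa>)
qed

lemma f_in_hyperplane0: "f \<theta> \<in> hyperplane0"
  by (simp add: hyperplane0_def f_nth sum_subtractf sum_distrib_left[symmetric])

lemma S_omega_subset_hyperplane0: "S_omega \<subseteq> hyperplane0"
  using f_in_hyperplane0 by (auto simp: S_omega_def)

lemma S_theta_I:
  assumes "\<And>i. \<kappa> i \<theta> > 0" and "(\<Sum>i\<in>UNIV. 1 / \<kappa> i \<theta>) \<le> 2"
  shows "\<theta> \<in> S_theta"
proof -
  have "1 / ereal (\<kappa> i \<theta>) = ereal (1 / \<kappa> i \<theta>)" for i
    using assms(1)[of i] by (simp add: one_ereal_def)
  then have "(\<Sum>i\<in>UNIV. 1 / ereal (\<kappa> i \<theta>)) = ereal (\<Sum>i\<in>UNIV. 1 / \<kappa> i \<theta>)"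
    by simp
  also have "\<dots> \<le> ereal 2"
    using assms(2) by (simp only: ereal_less_eq)
  finally show ?thesis
    using assms(1) by (auto simp: S_theta_def intro: less_imp_le)
qed

text \<open>Here \<open>u\<close> stands for the common value of the sum of all
  \<open>\<kappa> i \<theta>\<close> and of
  \<open>(f \<theta> $ i)\<^sup>2 + (\<kappa> i \<theta>)\<^sup>2\<close>. Weakening these equations
  to inequalities makes the set of triples of \<open>\<omega>\<close>, \<open>u\<close>,
  \<open>k\<close> convex.\<close>

definition relaxed_S_omega :: "(real ^ 'n) set" where
  "relaxed_S_omega = {\<omega> \<in> hyperplane0.
     \<exists>u k. (\<forall>i. 0 \<le> k i \<and> (k i)\<^sup>2 + (\<omega> $ i)\<^sup>2 \<le> u) \<and> u \<le> (\<Sum>i\<in>UNIV. k i)}"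

lemma f_in_relaxed_S_omega:
  assumes "\<And>i. \<kappa> i \<theta> \<ge> 0"
  shows "f \<theta> \<in> relaxed_S_omega"
  unfolding relaxed_S_omega_def
  using assms f_in_hyperplane0 f_power2_add_\<kappa>_power2[of \<theta>]
  by (auto intro!: exI[of _ "\<Sum>j\<in>UNIV. \<kappa> j \<theta>"] exI[of _ "\<lambda>i. \<kappa> i \<theta>"] simp: add.commute)

section \<open>Convexity of the relaxation\<close>

lemma convex_hyperplane0: "convex hyperplane0"
  by (rule convexI) (simp add: hyperplane0_def sum.distrib sum_distrib_left[symmetric])

lemma power2_convex_combination_le:
  fixes a b x y :: real
  assumes "0 \<le> a" "0 \<le> b" "a + b = 1"
  shows "(a * x + b * y)\<^sup>2 \<le> a * x\<^sup>2 + b * y\<^sup>2"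
proof -
  have a: "a = 1 - b"
    using assms(3) by simp
  have "a * x\<^sup>2 + b * y\<^sup>2 - (a * x + b * y)\<^sup>2 = a * b * (x - y)\<^sup>2"
    unfolding a by (simp add: power2_eq_square algebra_simps)
  also have "\<dots> \<ge> 0"
    using assms by simp
  finally show ?thesis
    by simp
qed

lemma convex_relaxed_S_omega: "convex relaxed_S_omega"
proof (rule convexI)
  fix x y :: "real ^ 'n" and a b :: real
  assume xy: "x \<in> relaxed_S_omega" "y \<in> relaxed_S_omega" and ab: "0 \<le> a" "0 \<le> b" "a + b = 1"
  obtain u k where k: "\<And>i. 0 \<le> k i" "\<And>i. (k i)\<^sup>2 + (x $ i)\<^sup>2 \<le> u" "u \<le> (\<Sum>i\<in>UNIV. k i)"
    using xy(1) by (auto simp: relaxed_S_omega_def)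
  obtain v l where l: "\<And>i. 0 \<le> l i" "\<And>i. (l i)\<^sup>2 + (y $ i)\<^sup>2 \<le> v" "v \<le> (\<Sum>i\<in>UNIV. l i)"
    using xy(2) by (auto simp: relaxed_S_omega_def)
  have "a *\<^sub>R x + b *\<^sub>R y \<in> hyperplane0"
    using convex_hyperplane0 xy ab by (auto simp: convex_def relaxed_S_omega_def)
  moreover have "0 \<le> a * k i + b * l i" for i
    using k(1) l(1) ab by simp
  moreover have "(a * k i + b * l i)\<^sup>2 + ((a *\<^sub>R x + b *\<^sub>R y) $ i)\<^sup>2 \<le> a * u + b * v" for i
  proof -
    have "a * ((k i)\<^sup>2 + (x $ i)\<^sup>2) + b * ((l i)\<^sup>2 + (y $ i)\<^sup>2) \<le> a * u + b * v"
      using k(2) l(2) ab by (intro add_mono mult_left_mono) auto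
    then show ?thesis
      using power2_convex_combination_le[OF ab, of "k i" "l i"]
        power2_convex_combination_le[OF ab, of "x $ i" "y $ i"]
      by (simp add: algebra_simps)
  qed
  moreover have "a * u + b * v \<le> (\<Sum>i\<in>UNIV. a * k i + b * l i)"
    using k(3) l(3) ab by (simp add: sum.distrib sum_distrib_left[symmetric] add_mono mult_left_mono)
  ultimately show "a *\<^sub>R x + b *\<^sub>R y \<in> relaxed_S_omega"
    unfolding relaxed_S_omega_def
    by (intro CollectI conjI exI[of _ "a * u + b * v"] exI[of _ "\<lambda>i. a * k i + b * l i"]) auto
qed

text \<open>A common rotation of the angles may be chosen so that the sines sum to 0 and the cosines
  to \<open>r = sqrt u\<close>. Then \<open>f\<close> has components
  \<open>- r * sin (\<theta> $ i)\<close>, which dictates the arcsine; its nonnegative cosine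
  matches \<open>k i \<ge> 0\<close>.\<close>

lemma f_preimage:
  assumes \<omega>: "\<omega> \<in> hyperplane0" and u: "u > 0" and k: "\<And>i. 0 \<le> k i"
    and ku: "\<And>i. (k i)\<^sup>2 + (\<omega> $ i)\<^sup>2 = u" and sum: "(\<Sum>i\<in>UNIV. k i) = u"
  obtains \<theta> where "f \<theta> = \<omega>" "\<And>i. \<kappa> i \<theta> = k i"
proof -
  define r where "r = sqrt u"
  have r: "r > 0" "r\<^sup>2 = u"
    using u by (auto simp: r_def)
  define \<theta> :: "real ^ 'a" where "\<theta> = (\<chi> i. - arcsin (\<omega> $ i / r))"
  have "(k i / r)\<^sup>2 + (\<omega> $ i / r)\<^sup>2 = 1" for i
    using ku[of i] r u by (simp add: power_divide flip: add_divide_distrib)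
  then have sq: "1 - (\<omega> $ i / r)\<^sup>2 = (k i / r)\<^sup>2" for i
    by (metis add_diff_cancel_right')
  have bd: "- 1 \<le> \<omega> $ i / r \<and> \<omega> $ i / r \<le> 1" for i
  proof -
    have "(\<omega> $ i / r)\<^sup>2 \<le> 1"
      using sq[of i] zero_le_power2[of "k i / r"] by linarith
    then show ?thesis
      by (metis abs_le_iff abs_square_le_1 minus_le_iff)
  qed
  have s: "sin (\<theta> $ i) = - (\<omega> $ i / r)" for i
    using bd[of i] by (simp add: \<theta>_def)
  have c: "cos (\<theta> $ i) = k i / r" for i
  proof -
    have "cos (\<theta> $ i) = sqrt ((k i / r)\<^sup>2)"
      using bd[of i] by (simp add: \<theta>_def cos_arcsin sq del: power_divide)
    then show ?thesis
      using k[of i] r by simp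
  qed
  have S: "(\<Sum>j\<in>UNIV. sin (\<theta> $ j)) = 0"
    using \<omega> by (simp add: s sum_negf hyperplane0_def sum_divide_distrib[symmetric])
  have C: "(\<Sum>j\<in>UNIV. cos (\<theta> $ j)) = r"
    using sum r by (simp add: c sum_divide_distrib[symmetric] power2_eq_square field_simps)
  have "f \<theta> = \<omega>"
    using r unfolding vec_eq_iff f_nth S C by (simp add: s)
  moreover have "\<kappa> i \<theta> = k i" for i
    using r unfolding \<kappa>_eq S C by (simp add: c)
  ultimately show thesis
    using that by blast
qed

lemma relaxed_S_omega_subset: "(relaxed_S_omega :: (real ^ 'n) set) \<subseteq> S_omega"
proof
  fix \<omega> :: "real ^ 'n"
  assume "\<omega> \<in> relaxed_S_omega"
  then obtain u0 k0 where H: "\<omega> \<in> hyperplane0"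
    and k0: "\<And>i. 0 \<le> k0 i" "\<And>i. (k0 i)\<^sup>2 + (\<omega> $ i)\<^sup>2 \<le> u0" "u0 \<le> (\<Sum>i\<in>UNIV. k0 i)"
    by (auto simp: relaxed_S_omega_def)
  define N where "N = real CARD('n)"
  have N: "N \<ge> 1"
    by (simp add: N_def Suc_le_eq)
  \<comment> \<open>Since \<open>sqrt\<close> is extended oddly to negative arguments,
    \<open>h\<close> is continuous on the whole line; the bound \<open>M \<le> u\<close> in
    \<open>A\<close> keeps the radicands nonnegative.\<close>
  define h where "h u = u - (\<Sum>i\<in>UNIV. sqrt (u - (\<omega> $ i)\<^sup>2))" for u
  define M where "M = Max (range (\<lambda>i. (\<omega> $ i)\<^sup>2))"
  have M_ge: "(\<omega> $ i)\<^sup>2 \<le> M" for i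
    by (simp add: M_def)
  have "M \<in> range (\<lambda>i. (\<omega> $ i)\<^sup>2)"
    unfolding M_def by (rule Max_in) auto
  then obtain m where m: "(\<omega> $ m)\<^sup>2 = M"
    by (auto simp: image_iff)
  define A where "A = {u. M \<le> u \<and> h u \<le> 0}"
  have "k0 i \<le> sqrt (u0 - (\<omega> $ i)\<^sup>2)" for i
    using k0(2)[of i] by (intro real_le_rsqrt) simp
  then have "h u0 \<le> 0"
    using k0(3) sum_mono[of UNIV k0 "\<lambda>i. sqrt (u0 - (\<omega> $ i)\<^sup>2)"] by (simp add: h_def)
  moreover have "M \<le> u0"
    using k0(2)[of m] m zero_le_power2[of "k0 m"] by linarith
  ultimately have u0: "u0 \<in> A"
    by (simp add: A_def)
  have cont: "continuous_on UNIV h"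
    unfolding h_def by (intro continuous_intros)
  have "u \<le> N\<^sup>2" if "u \<in> A" for u
  proof -
    have u: "0 \<le> u"
      using that order_trans[OF zero_le_power2 M_ge[of m]] by (auto simp: A_def)
    have "u \<le> (\<Sum>i\<in>UNIV. sqrt (u - (\<omega> $ i)\<^sup>2))"
      using that by (simp add: A_def h_def)
    also have "\<dots> \<le> (\<Sum>i\<in>(UNIV :: 'n set). sqrt u)"
      by (intro sum_mono) simp
    finally have "sqrt u * sqrt u \<le> N * sqrt u"
      using u by (simp add: N_def)
    then have "sqrt u \<le> N"
      using N u mult_right_le_imp_le[of "sqrt u" "sqrt u" N] by (cases "u = 0") auto
    then show ?thesis
      using sqrt_le_D by blast
  qed
  then have bdd: "bdd_above A"
    by (rule bdd_aboveI)
  have "closed A"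
  proof -
    have "A = {M..} \<inter> {u. h u \<le> 0}"
      by (auto simp: A_def)
    then show ?thesis
      using cont by (auto intro!: closed_Int closed_Collect_le)
  qed
  then have Sup_A: "Sup A \<in> A"
    using u0 bdd by (intro closed_contains_Sup) auto
  have A_le: "u \<le> Sup A" if "u \<in> A" for u
    using that bdd by (rule cSup_upper)
  define U where "U = Sup A"
  have U: "M \<le> U" "h U \<le> 0"
    using Sup_A by (auto simp: A_def U_def)
  have after: "h u > 0" if "u > U" for u
    using A_le[of u] that U by (force simp: A_def U_def)
  \<comment> \<open>Strictness makes every root positive and \<open>h\<close> differentiable at
    \<open>U\<close>. If \<open>U = M\<close>, the root with index \<open>m\<close> vanishes there,
    and moving right by \<open>e\<close> costs \<open>e\<close> but gains at least
    \<open>sqrt e\<close>. With \<open>e = 1/4\<close> this gives \<open>h (M + e) \<le> 0\<close>,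
    against the maximality of \<open>U\<close>.\<close>
  have "M < U"
  proof (rule ccontr)
    assume "\<not> M < U"
    then have UM: "U = M"
      using U by simp
    define e :: real where "e = 1 / 4"
    have "h (M + e) = (M + e) - ((\<Sum>i\<in>UNIV - {m}. sqrt (M + e - (\<omega> $ i)\<^sup>2)) + sqrt e)"
      using m by (simp add: h_def sum.remove[of UNIV m])
    also have "\<dots> \<le> (M + e) - ((\<Sum>i\<in>UNIV - {m}. sqrt (M - (\<omega> $ i)\<^sup>2)) + sqrt e)"
      by (intro diff_mono add_mono sum_mono order_refl) (simp add: e_def)
    also have "\<dots> = h M + e - sqrt e"
      using m by (simp add: h_def sum.remove[of UNIV m])
    also have "\<dots> \<le> 0"
      using U UM by (simp add: e_def real_sqrt_divide)
    finally show False
      using after[of "M + e"] UM by (simp add: e_def)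
  qed
  then have pos: "U - (\<omega> $ i)\<^sup>2 > 0" for i
    using M_ge[of i] by simp
  \<comment> \<open>A negative value would persist just to the right of \<open>U\<close>,
    contradicting \<open>after\<close>.\<close>
  have "h U = 0"
  proof (rule ccontr)
    assume "h U \<noteq> 0"
    then have "h U < 0"
      using U by simp
    moreover have "continuous (at_right U) h"
      using cont by (simp add: continuous_on_eq_continuous_at continuous_at_imp_continuous_at_within)
    ultimately have "eventually (\<lambda>u. h u < 0) (at_right U)"
      by (auto simp: continuous_within intro: order_tendstoD)
    moreover have "eventually (\<lambda>u. u > U) (at_right U)"
      by (simp add: eventually_at_filter)
    ultimately have "eventually (\<lambda>u. False) (at_right U)"
      by eventually_elim (use after in fastforce)
    then show False
      by simp
  qed
  then have sum_U: "(\<Sum>i\<in>UNIV. sqrt (U - (\<omega> $ i)\<^sup>2)) = U"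
    by (simp add: h_def)
  have "((\<lambda>u. sqrt (u - (\<omega> $ i)\<^sup>2)) has_real_derivative inverse (sqrt (U - (\<omega> $ i)\<^sup>2)) / 2) (at U)"
    for i
    using pos[of i] by (auto intro!: derivative_eq_intros)
  then have "(h has_real_derivative (1 - (\<Sum>i\<in>UNIV. inverse (sqrt (U - (\<omega> $ i)\<^sup>2)) / 2))) (at U)"
    unfolding h_def by (intro DERIV_diff DERIV_ident DERIV_sum)
  \<comment> \<open>A negative derivative at the zero \<open>U\<close> would make \<open>h\<close>
    negative just to its right.\<close>
  then have "1 - (\<Sum>i\<in>UNIV. inverse (sqrt (U - (\<omega> $ i)\<^sup>2)) / 2) \<ge> 0"
    using DERIV_neg_dec_right[of h _ U] after \<open>h U = 0\<close>
    by (smt (verit) field_sum_of_halves)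
  then have inv: "(\<Sum>i\<in>UNIV. 1 / sqrt (U - (\<omega> $ i)\<^sup>2)) \<le> 2"
    by (simp flip: sum_divide_distrib inverse_eq_divide)
  have "U > 0"
    using pos[of m] zero_le_power2[of "\<omega> $ m"] by linarith
  moreover have "0 \<le> sqrt (U - (\<omega> $ i)\<^sup>2)" "(sqrt (U - (\<omega> $ i)\<^sup>2))\<^sup>2 + (\<omega> $ i)\<^sup>2 = U" for i
    using pos[of i] by auto
  ultimately obtain \<theta> where \<theta>: "f \<theta> = \<omega>" "\<And>i. \<kappa> i \<theta> = sqrt (U - (\<omega> $ i)\<^sup>2)"
    using f_preimage[OF H, of U "\<lambda>i. sqrt (U - (\<omega> $ i)\<^sup>2)"] sum_U by blast
  have "\<theta> \<in> S_theta"
    using pos inv by (intro S_theta_I) (auto simp: \<theta>)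
  then show "\<omega> \<in> S_omega"
    using \<theta>(1) by (auto simp: S_omega_def)
qed

lemma S_omega_eq_relaxed: "S_omega = relaxed_S_omega"
  using relaxed_S_omega_subset f_in_relaxed_S_omega by (fastforce simp: S_omega_def S_theta_def)

section \<open>Boundary points\<close>

text \<open>To first order, changing \<open>u\<close> gains nothing at \<open>\<theta>\<close>,
  because the reciprocals sum to exactly 2. The tangent bounds therefore leave only the strict loss
  caused by enlarging \<open>\<omega>\<close>.\<close>

lemma scaled_notin_S_omega:
  assumes pos: "\<And>i. \<kappa> i \<theta> > 0" and eq2: "(\<Sum>i\<in>UNIV. 1 / \<kappa> i \<theta>) = 2" and nz: "f \<theta> \<noteq> 0"
    and t: "t > 1"
  shows "t *\<^sub>R f \<theta> \<notin> S_omega"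
proof
  assume "t *\<^sub>R f \<theta> \<in> S_omega"
  then obtain \<phi> where \<phi>: "f \<phi> = t *\<^sub>R f \<theta>"
    by (auto simp: S_omega_def)
  define c where "c i = \<kappa> i \<theta>" for i
  define x where "x i = (f \<theta> $ i)\<^sup>2" for i
  define u where "u = (\<Sum>i\<in>UNIV. \<kappa> i \<phi>)"
  define w where "w = (\<Sum>i\<in>UNIV. c i)"
  have c: "c i > 0" for i
    using pos by (simp add: c_def)
  have x: "x i = w - (c i)\<^sup>2" for i
    using f_power2_add_\<kappa>_power2[of \<theta> i] by (simp add: x_def c_def w_def)
  have "\<kappa> i \<phi> \<le> (u - w) / 2 * (1 / c i) + c i - (t\<^sup>2 - 1) * (x i / (2 * c i))" for i
  proof -
    have "(\<kappa> i \<phi>)\<^sup>2 = u - t\<^sup>2 * x i"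
      using f_power2_add_\<kappa>_power2[of \<phi> i] by (simp add: \<phi> u_def x_def power_mult_distrib)
    moreover have tx: "(t\<^sup>2 - 1) * x i = t\<^sup>2 * x i - x i"
      by (simp add: left_diff_distrib)
    moreover have "2 * c i * \<kappa> i \<phi> \<le> (\<kappa> i \<phi>)\<^sup>2 + (c i)\<^sup>2"
      using zero_le_power2[of "\<kappa> i \<phi> - c i"] by (simp add: power2_diff algebra_simps)
    ultimately have "2 * c i * \<kappa> i \<phi> \<le> u - w + 2 * (c i)\<^sup>2 - (t\<^sup>2 - 1) * x i"
      using x[of i] tx by linarith
    then have "\<kappa> i \<phi> \<le> (u - w + 2 * (c i)\<^sup>2 - (t\<^sup>2 - 1) * x i) / (2 * c i)"
      using c[of i] by (simp add: field_simps)
    also have "\<dots> = (u - w) / 2 * (1 / c i) + c i - (t\<^sup>2 - 1) * (x i / (2 * c i))"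
      using c[of i] by (simp add: field_simps power2_eq_square)
    finally show ?thesis .
  qed
  then have "u \<le> (\<Sum>i\<in>UNIV. (u - w) / 2 * (1 / c i) + c i - (t\<^sup>2 - 1) * (x i / (2 * c i)))"
    unfolding u_def by (intro sum_mono) auto
  also have "\<dots> = (u - w) / 2 * (\<Sum>i\<in>UNIV. 1 / c i) + w - (t\<^sup>2 - 1) * (\<Sum>i\<in>UNIV. x i / (2 * c i))"
    by (simp only: sum.distrib sum_subtractf sum_distrib_left[symmetric] w_def)
  \<comment> \<open>By \<open>eq2\<close> the coefficient of \<open>u - w\<close> is 1, so
    \<open>u\<close> cancels from the inequality.\<close>
  also have "\<dots> = u - (t\<^sup>2 - 1) * (\<Sum>i\<in>UNIV. x i / (2 * c i))"
    using eq2 by (simp add: c_def field_simps)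
  finally have "(t\<^sup>2 - 1) * (\<Sum>i\<in>UNIV. x i / (2 * c i)) \<le> 0"
    by simp
  moreover have "t\<^sup>2 - 1 > 0"
    using t by simp
  moreover have "(\<Sum>i\<in>UNIV. x i / (2 * c i)) > 0"
  proof -
    obtain i where "f \<theta> $ i \<noteq> 0"
      using nz by (auto simp: vec_eq_iff)
    then have "x i / (2 * c i) > 0"
      using c[of i] by (simp add: x_def)
    moreover have "x j / (2 * c j) \<ge> 0" for j
      using c[of j] by (simp add: x_def)
    ultimately show ?thesis
      by (intro sum_pos2[of UNIV i]) auto
  qed
  ultimately show False
    by (simp add: mult_le_0_iff)
qed

lemma f_in_frontier_of_S_omega:
  fixes \<theta> :: "real ^ 'n"
  assumes "\<And>i. \<kappa> i \<theta> > 0" and "(\<Sum>i\<in>UNIV. 1 / \<kappa> i \<theta>) = 2" and "f \<theta> \<noteq> 0"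
  shows "f \<theta> \<in> (top_of_set hyperplane0) frontier_of S_omega"
proof -
  let ?X = "top_of_set (hyperplane0 :: (real ^ 'n) set)"
  have "f \<theta> \<in> S_omega"
    using assms by (auto simp: S_omega_def intro!: S_theta_I)
  then have "f \<theta> \<in> ?X closure_of S_omega"
    using closure_of_subset[of S_omega ?X] S_omega_subset_hyperplane0 by auto
  moreover have "f \<theta> \<notin> ?X interior_of S_omega"
  proof
    assume int: "f \<theta> \<in> ?X interior_of S_omega"
    obtain T where T: "open T" "?X interior_of S_omega = hyperplane0 \<inter> T"
      using openin_interior_of[of ?X S_omega] unfolding openin_open by blast
    \<comment> \<open>The ray \<open>t *\<^sub>R f \<theta>\<close> with \<open>t > 1\<close> stays
      in the hyperplane and approaches \<open>f \<theta>\<close> from outside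
      \<open>S_omega\<close>.\<close>
    have "((\<lambda>t. t *\<^sub>R f \<theta>) \<longlongrightarrow> 1 *\<^sub>R f \<theta>) (at_right (1 :: real))"
      by (intro tendsto_intros)
    then have "eventually (\<lambda>t. t *\<^sub>R f \<theta> \<in> T) (at_right (1 :: real))"
      using T int by (auto dest: topological_tendstoD)
    moreover have "eventually (\<lambda>t. t > 1) (at_right (1 :: real))"
      by (simp add: eventually_at_filter)
    ultimately have "eventually (\<lambda>t. t > 1 \<and> t *\<^sub>R f \<theta> \<in> T) (at_right (1 :: real))"
      by eventually_elim auto
    then obtain t :: real where t: "t > 1" "t *\<^sub>R f \<theta> \<in> T"
      using eventually_happens'[of "at_right (1 :: real)"] by auto
    moreover have "t *\<^sub>R f \<theta> \<in> hyperplane0"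
      using f_in_hyperplane0[of \<theta>] by (simp add: hyperplane0_def sum_distrib_left[symmetric])
    ultimately have "t *\<^sub>R f \<theta> \<in> S_omega"
      using T(2) interior_of_subset[of ?X S_omega] by auto
    then show False
      using scaled_notin_S_omega[OF assms t(1)] by simp
  qed
  ultimately show ?thesis
    by (simp add: frontier_of_def)
qed

text \<open>The cosine of a difference is 1 within a block of equal coordinates and 0 across blocks,
  so \<open>\<kappa> i v\<close> is the size of the block of \<open>i\<close>. Each of the two
  nonempty blocks contributes 1 to the sum of reciprocals.\<close>

lemma V_properties:
  fixes v :: "real ^ 'n"
  assumes "v \<in> V"
  shows "\<kappa> i v > 0" and "(\<Sum>i\<in>UNIV. 1 / \<kappa> i v) = 2" and "f v \<noteq> 0"
proof -
  define A B where "A = {i. v $ i = 0}" and "B = {i. v $ i = pi / 2}"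
  have v: "v $ i = 0 \<or> v $ i = pi / 2" for i
    using assms by (auto simp: V_def)
  have ne: "A \<noteq> {}" "B \<noteq> {}"
    using assms v by (auto simp: V_def vec_eq_iff A_def B_def)
  have un: "UNIV = A \<union> B" and disj: "A \<inter> B = {}"
    using v by (auto simp: A_def B_def)
  have split: "(\<Sum>i\<in>UNIV. g i) = (\<Sum>i\<in>A. g i) + (\<Sum>i\<in>B. g i)" for g :: "'n \<Rightarrow> real"
    unfolding un using disj by (intro sum.union_disjoint) auto
  have vA: "v $ i = 0" if "i \<in> A" for i
    using that by (simp add: A_def)
  have vB: "v $ i = pi / 2" if "i \<in> B" for i
    using that by (simp add: B_def)
  have kA: "\<kappa> i v = card A" if "i \<in> A" for i
    using that by (simp add: \<kappa>_def split vA vB cong: sum.cong)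
  have kB: "\<kappa> i v = card B" if "i \<in> B" for i
    using that by (simp add: \<kappa>_def split vA vB cong: sum.cong)
  have cards: "card A > 0" "card B > 0"
    using ne by (auto simp: card_gt_0_iff)
  show "\<kappa> i v > 0"
    using un cards kA[of i] kB[of i] by force
  show "(\<Sum>i\<in>UNIV. 1 / \<kappa> i v) = 2"
    using cards ne by (simp add: split kA kB)
  obtain i where i: "i \<in> A"
    using ne by blast
  then have "f v $ i = card B"
    by (simp add: f_def split vA vB cong: sum.cong)
  then show "f v \<noteq> 0"
    using cards by auto
qed

section \<open>The Voronoi cell\<close>

text \<open>The linearization of \<open>f\<close> at 0, which is \<open>- N\<close> times the
  orthogonal projection onto \<open>hyperplane0\<close>; constant vectors are its kernel.\<close>

definition pairwise_diff_sum :: "real ^ 'n \<Rightarrow> real ^ 'n" where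
  "pairwise_diff_sum y = (\<chi> i. \<Sum>j\<in>UNIV. y $ j - y $ i)"

lemma linear_pairwise_diff_sum: "linear pairwise_diff_sum"
  by (rule linearI)
    (simp_all add: pairwise_diff_sum_def vec_eq_iff sum_subtractf sum.distrib algebra_simps
      sum_distrib_left)

text \<open>On differences of values in \<open>{0, \<pi>/2}\<close> the sine is linear.\<close>

lemma f_eq_pairwise_diff_sum:
  assumes "\<And>i. y $ i = 0 \<or> y $ i = 1"
  shows "f ((pi / 2) *\<^sub>R y) = pairwise_diff_sum y"
proof -
  have "sin (pi / 2 * y $ j - pi / 2 * y $ i) = y $ j - y $ i" for i j
    using assms[of i] assms[of j] by auto
  then show ?thesis
    by (simp add: f_def pairwise_diff_sum_def)
qed

lemma pairwise_diff_sum_vertex_in_f_V: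
  assumes "\<And>i. y $ i = 0 \<or> y $ i = 1" and "y $ a = 0" and "y $ b = 1"
  shows "pairwise_diff_sum y \<in> f ` V"
proof -
  have "y $ a \<noteq> 1" "y $ b \<noteq> 0"
    using assms(2,3) by auto
  then have "(pi / 2) *\<^sub>R y \<in> V"
    using assms(1) by (auto simp: V_def vec_eq_iff)
  then show ?thesis
    using f_eq_pairwise_diff_sum[OF assms(1)] by (metis imageI)
qed

lemma f_V_vertex:
  assumes "\<omega> \<in> f ` V"
  obtains y where "\<And>i. y $ i = 0 \<or> y $ i = 1" "\<omega> = pairwise_diff_sum y"
proof -
  obtain v where v: "v \<in> V" "\<omega> = f v"
    using assms by auto
  have "((2 / pi) *\<^sub>R v) $ i = 0 \<or> ((2 / pi) *\<^sub>R v) $ i = 1" for i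
    using v(1) by (auto simp: V_def)
  moreover from f_eq_pairwise_diff_sum[OF this] have "\<omega> = pairwise_diff_sum ((2 / pi) *\<^sub>R v)"
    using v(2) by simp
  ultimately show thesis
    by (rule that)
qed

text \<open>A 0-1 vector and its complement add up to a constant vector, so their images are
  opposite; with at least two coordinates, both can be nonconstant.\<close>

lemma zero_in_P:
  assumes "CARD('n::finite) \<ge> 2"
  shows "(0 :: real ^ 'n) \<in> P"
proof -
  obtain a b :: 'n where ab: "a \<noteq> b"
    using assms card_2_iff' ex_card[of 2 "UNIV :: 'n set"] by (metis iso_tuple_UNIV_I)
  define y z :: "real ^ 'n"
    where "y = (\<chi> i. if i = a then 1 else 0)" and "z = (\<chi> i. if i = a then 0 else 1)"
  have "pairwise_diff_sum y \<in> f ` V"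
    using ab by (intro pairwise_diff_sum_vertex_in_f_V[of _ b a]) (auto simp: y_def)
  moreover have "pairwise_diff_sum z \<in> f ` V"
    using ab by (intro pairwise_diff_sum_vertex_in_f_V[of _ a b]) (auto simp: z_def)
  ultimately have "(1 / 2) *\<^sub>R pairwise_diff_sum y + (1 / 2) *\<^sub>R pairwise_diff_sum z \<in> P"
    unfolding P_def by (intro convexD[OF convex_convex_hull] hull_inc) auto
  also have "(1 / 2) *\<^sub>R pairwise_diff_sum y + (1 / 2) *\<^sub>R pairwise_diff_sum z
      = (1 / 2) *\<^sub>R pairwise_diff_sum (y + z)"
    by (simp add: linear_add[OF linear_pairwise_diff_sum] scaleR_right_distrib)
  also have "y + z = (\<chi> i. 1)"
    by (simp add: y_def z_def vec_eq_iff)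
  also have "(1 / 2) *\<^sub>R pairwise_diff_sum \<dots> = 0"
    by (simp add: pairwise_diff_sum_def vec_eq_iff)
  finally show ?thesis .
qed

lemma pairwise_diff_sum_cube_subset_P:
  assumes "CARD('n::finite) \<ge> 2"
  shows "pairwise_diff_sum ` cbox (0 :: real ^ 'n) One \<subseteq> P"
proof -
  let ?E = "{x :: real ^ 'n. \<forall>i\<in>Basis. x \<bullet> i = 0 \<or> x \<bullet> i = 1}"
  have "pairwise_diff_sum y \<in> P" if "y \<in> ?E" for y
  proof -
    have y: "y $ i = 0 \<or> y $ i = 1" for i
      using that by (auto simp: Basis_vec_def inner_axis)
    show ?thesis
    proof (cases "\<exists>a b. y $ a = 0 \<and> y $ b = 1")
      case True
      then show ?thesis
        using y pairwise_diff_sum_vertex_in_f_V[of y] by (auto simp: P_def intro: hull_inc)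
    next
      case False
      then have "y $ j - y $ i = 0" for i j
        using y[of i] y[of j] by auto
      then have "pairwise_diff_sum y = 0"
        by (simp only: pairwise_diff_sum_def sum.neutral_const zero_vec_def)
      then show ?thesis
        using zero_in_P[OF assms] by simp
    qed
  qed
  then have "convex hull (pairwise_diff_sum ` ?E) \<subseteq> P"
    by (intro hull_minimal) (auto simp: P_def)
  then show ?thesis
    by (simp add: unit_interval_convex_hull convex_hull_linear_image[OF linear_pairwise_diff_sum])
qed

section \<open>The Voronoi cell as an intersection of half-spaces\<close>

lemma norm_le_dist_iff:
  fixes x v :: "'a::real_inner"
  shows "norm x \<le> dist x v \<longleftrightarrow> v \<bullet> x \<le> v \<bullet> v / 2"
  by (simp add: dist_norm norm_le inner_diff inner_commute mult.commute)

lemma convex_voronoi_cell: "convex (voronoi_cell :: (real ^ 'n) set)"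
proof -
  have "(voronoi_cell :: (real ^ 'n) set)
      = hyperplane0 \<inter> (\<Inter>v\<in>root_lattice. {x. v \<bullet> x \<le> v \<bullet> v / 2})"
    by (auto simp: voronoi_cell_def norm_le_dist_iff)
  also have "convex \<dots>"
    by (intro convex_Int convex_hyperplane0 convex_INT convex_halfspace_le)
  finally show ?thesis .
qed

lemma voronoi_cell_diff_le_1:
  assumes "x \<in> voronoi_cell"
  shows "x $ i - x $ j \<le> 1"
proof (cases "i = j")
  case False
  \<comment> \<open>The bound is the half-space of the root \<open>?v\<close>, whose squared norm is
    2.\<close>
  let ?v = "axis i 1 - axis j 1 :: real ^ 'a"
  have "?v \<in> root_lattice"
    by (auto simp: root_lattice_def axis_def sum_subtractf)
  then have "?v \<bullet> x \<le> ?v \<bullet> ?v / 2"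
    using assms by (simp add: voronoi_cell_def norm_le_dist_iff)
  moreover have "?v \<bullet> x = x $ i - x $ j"
    by (simp add: inner_diff_left inner_axis')
  moreover have "?v \<bullet> ?v = 2"
    using False by (simp add: inner_diff inner_axis_axis)
  ultimately show ?thesis
    by simp
qed simp

lemma scaled_voronoi_cell_subset_P:
  assumes "CARD('n::finite) \<ge> 2" and "x \<in> voronoi_cell"
  shows "real CARD('n) *\<^sub>R x \<in> (P :: (real ^ 'n) set)"
proof -
  define M where "M = Max (range (\<lambda>i. x $ i))"
  have M_ge: "x $ i \<le> M" for i
    by (simp add: M_def)
  have "M \<in> range (\<lambda>i. x $ i)"
    unfolding M_def by (rule Max_in) auto
  then obtain m where m: "x $ m = M"
    by (auto simp: image_iff)
  \<comment> \<open>On the hyperplane \<open>pairwise_diff_sum\<close> multiplies by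
    \<open>- N\<close>, hence the sign of \<open>x\<close>. The shift by \<open>M\<close> lies in
    the kernel and moves the point into the unit cube, as coordinates of \<open>x\<close> differ by
    at most 1.\<close>
  define y :: "real ^ 'n" where "y = (\<chi> i. M - x $ i)"
  have "\<forall>b\<in>Basis. 0 \<le> y \<bullet> b \<and> y \<bullet> b \<le> 1"
    using M_ge voronoi_cell_diff_le_1[OF assms(2), of m] m
    by (auto simp: y_def Basis_vec_def inner_axis)
  then have "y \<in> cbox 0 One"
    by (simp add: mem_box)
  moreover have "pairwise_diff_sum y = real CARD('n) *\<^sub>R x"
    using assms(2)
    by (simp add: pairwise_diff_sum_def y_def vec_eq_iff sum_subtractf voronoi_cell_def hyperplane0_def)
  ultimately show ?thesis
    using pairwise_diff_sum_cube_subset_P[OF assms(1)] by (metis imageI subsetD)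
qed

lemma vertex_in_voronoi_cell:
  fixes y :: "real ^ 'n"
  assumes y: "\<And>i. y $ i = 0 \<or> y $ i = 1"
  shows "(1 / real CARD('n)) *\<^sub>R pairwise_diff_sum y \<in> voronoi_cell"
proof -
  define N where "N = real CARD('n)"
  have N: "N > 0"
    by (simp add: N_def)
  let ?p = "(1 / N) *\<^sub>R pairwise_diff_sum y"
  have p: "?p $ i = (\<Sum>j\<in>UNIV. y $ j) / N - y $ i" for i
    using N by (simp add: pairwise_diff_sum_def sum_subtractf N_def field_simps)
  have "?p \<in> hyperplane0"
    using N by (simp add: hyperplane0_def p sum_subtractf del: vector_scaleR_component) (simp add: N_def)
  moreover have "2 * (?p \<bullet> v) \<le> v \<bullet> v" if "v \<in> root_lattice" for v
  proof -
    have v: "v $ i \<in> \<int>" "(\<Sum>i\<in>UNIV. v $ i) = 0" for i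
      using that by (auto simp: root_lattice_def)
    have "2 * (?p \<bullet> v) = (\<Sum>i\<in>UNIV. 2 * ((\<Sum>j\<in>UNIV. y $ j) / N) * v $ i - 2 * y $ i * v $ i)"
      by (simp add: inner_vec_def p sum_distrib_left algebra_simps del: vector_scaleR_component)
    \<comment> \<open>As \<open>v\<close> sums to zero, the constant factor on the first term can be
      replaced by 1. The factors \<open>1 - 2 * y $ i\<close> are then \<open>1\<close> or
      \<open>- 1\<close>, and integers satisfy \<open>\<bar>k\<bar> \<le> k * k\<close>.\<close>
    also have "\<dots> = (\<Sum>i\<in>UNIV. v $ i - 2 * y $ i * v $ i)"
      by (simp only: sum_subtractf sum_distrib_left[symmetric] v)
    also have "\<dots> \<le> (\<Sum>i\<in>UNIV. v $ i * v $ i)"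
    proof (rule sum_mono)
      fix i
      obtain k where k: "v $ i = of_int k"
        using v(1)[of i] by (auto elim: Ints_cases)
      have "\<bar>k\<bar> \<le> k * k"
        by (metis abs_mult_self_eq abs_ge_zero int_one_le_iff_zero_less less_le mult_left_mono mult.right_neutral mult_zero_left order_refl)
      then have "\<bar>v $ i\<bar> \<le> v $ i * v $ i"
        unfolding k by (metis of_int_abs of_int_le_iff of_int_mult)
      then show "v $ i - 2 * y $ i * v $ i \<le> v $ i * v $ i"
        using y[of i] by auto
    qed
    finally show ?thesis
      by (simp add: inner_vec_def)
  qed
  ultimately show ?thesis
    by (simp add: voronoi_cell_def norm_le_dist_iff N_def inner_commute mult.commute)
qed

lemma P_subset_scaled_voronoi_cell:
  "(P :: (real ^ 'n) set) \<subseteq> (\<lambda>x. real CARD('n) *\<^sub>R x) ` voronoi_cell"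
proof -
  have "\<omega> \<in> (\<lambda>x. real CARD('n) *\<^sub>R x) ` voronoi_cell" if \<omega>: "\<omega> \<in> f ` V" for \<omega> :: "real ^ 'n"
  proof -
    obtain y :: "real ^ 'n" where "\<And>i. y $ i = 0 \<or> y $ i = 1" "\<omega> = pairwise_diff_sum y"
      using f_V_vertex[OF \<omega>] by blast
    then show ?thesis
      using vertex_in_voronoi_cell[of y]
      by (intro image_eqI[of _ _ "(1 / real CARD('n)) *\<^sub>R pairwise_diff_sum y"]) auto
  qed
  then show ?thesis
    unfolding P_def by (intro hull_minimal convex_scaling convex_voronoi_cell) auto
qed

theorem corollary2p8:
  assumes "CARD('n::finite) \<ge> 2"
  shows "(P :: (real ^ 'n) set) \<subseteq> closure S_omega
       \<and> (P :: (real ^ 'n) set) = (\<lambda>x. real CARD('n) *\<^sub>R x) ` voronoi_cell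
       \<and> f ` (V :: (real ^ 'n) set) \<subseteq> (top_of_set hyperplane0) frontier_of S_omega"
proof (intro conjI)
  have "f ` V \<subseteq> (S_omega :: (real ^ 'n) set)"
    unfolding S_omega_def using V_properties by (intro image_mono subsetI S_theta_I eq_refl) auto
  \<comment> \<open>Convexity passes the inclusion from the vertices to their hull, already before
    taking the closure.\<close>
  then have "(P :: (real ^ 'n) set) \<subseteq> S_omega"
    unfolding P_def by (intro hull_minimal) (simp_all add: S_omega_eq_relaxed convex_relaxed_S_omega)
  then show "(P :: (real ^ 'n) set) \<subseteq> closure S_omega"
    using closure_subset by blast
  show "(P :: (real ^ 'n) set) = (\<lambda>x. real CARD('n) *\<^sub>R x) ` voronoi_cell"
    using P_subset_scaled_voronoi_cell scaled_voronoi_cell_subset_P[OF assms] by blast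
  show "f ` (V :: (real ^ 'n) set) \<subseteq> (top_of_set hyperplane0) frontier_of S_omega"
    using V_properties f_in_frontier_of_S_omega by blast
qed

end
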